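(* Let $N\ge2$ and $0<g_1<g_2<\cdots<g_N$. Let $\mathcal S^\circ=\{y\in(0,1)^N:\sum_iy_i=1\}$, and for $y\in\mathcal S^\circ$ and $j=1,\dots,N-1$ let $z_j(y)$ be the unique zero in $(g_j,g_{j+1})$ of $$m_y(z)=\sum_{i=1}^N\frac{y_i}{g_i-z}.$$ Then the map $y\mapsto z(y)=(z_1(y),\dots,z_{N-1}(y))$ is a real-analytic diffeomorphism from the open simplex $\mathcal S^\circ$ onto the interlacing box $\mathcal Z:=\prod_{j=1}^{N-1}(g_j,g_{j+1})$. Its inverse is $$y_i(z)=\frac{\prod_{j=1}^{N-1}(g_i-z_j)}{\prod_{m\ne i}(g_i-g_m)},\qquad i=1,\dots,N.$$
   Context: $\mathcal S^\circ$ is regarded as an open subset of the affine hyperplane $\{y\in\mathbb R^N:\sum_iy_i=1\}$. For $y\in\mathcal S^\circ$ the function $m_y$ has exactly one zero in each interval $(g_j,g_{j+1})$, so $z_j(y)$ is well defined. *)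

theory Defs
  imports "HOL-Analysis.Analysis"
begin

text \<open>
  Points of \<open>\<real>\<^sup>I\<close>, for a finite index set \<open>I\<close>, are the extensional functions in
  \<open>I \<rightarrow>\<^sub>E UNIV\<close>; so are multi-indices over \<open>I\<close>.
\<close>

definition monomial_at :: "'i set \<Rightarrow> ('i \<Rightarrow> real) \<Rightarrow> ('i \<Rightarrow> real) \<Rightarrow> ('i \<Rightarrow> nat) \<Rightarrow> real" where
  "monomial_at I a x \<alpha> = (\<Prod>i\<in>I. (x i - a i) ^ \<alpha> i)"

text \<open>
  Near each point \<open>a\<close> of \<open>U\<close>, \<open>f\<close> agrees on \<open>U\<close> with the sum of a multivariate power series that
  converges (absolutely, as \<open>summable_on\<close> is unconditional) on a full neighbourhood of \<open>a\<close> in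
  \<open>\<real>\<^sup>I\<close>. For \<open>U\<close> open in \<open>\<real>\<^sup>I\<close> this is the usual notion of real-analyticity. For \<open>U\<close> open in an
  affine subspace it says that \<open>f\<close> is locally the restriction of a real-analytic function of the
  ambient space, which is the same as being real-analytic in affine coordinates of the subspace
  (compose with an affine projection onto it).
\<close>

definition real_analytic_on :: "'i set \<Rightarrow> ('i \<Rightarrow> real) set \<Rightarrow> (('i \<Rightarrow> real) \<Rightarrow> real) \<Rightarrow> bool" where
  "real_analytic_on I U f \<longleftrightarrow>
     (\<forall>a\<in>U. \<exists>r>0. \<exists>c :: ('i \<Rightarrow> nat) \<Rightarrow> real.
        (\<forall>x \<in> I \<rightarrow>\<^sub>E UNIV. (\<forall>i\<in>I. \<bar>x i - a i\<bar> < r) \<longrightarrow>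
           (\<lambda>\<alpha>. c \<alpha> * monomial_at I a x \<alpha>) summable_on (I \<rightarrow>\<^sub>E UNIV)) \<and>
        (\<forall>x\<in>U. (\<forall>i\<in>I. \<bar>x i - a i\<bar> < r) \<longrightarrow>
           ((\<lambda>\<alpha>. c \<alpha> * monomial_at I a x \<alpha>) has_sum f x) (I \<rightarrow>\<^sub>E UNIV)))"

text \<open>
  \<open>U\<close> and \<open>V\<close> are open subsets of the affine subspaces \<open>H\<close> of \<open>\<real>\<^sup>I\<close> and \<open>K\<close> of \<open>\<real>\<^sup>J\<close>; a map into an
  affine subspace is real-analytic iff its ambient coordinates are.
\<close>

definition real_analytic_diffeomorphism ::
  "'i set \<Rightarrow> ('i \<Rightarrow> real) set \<Rightarrow> ('i \<Rightarrow> real) set \<Rightarrow>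
   'j set \<Rightarrow> ('j \<Rightarrow> real) set \<Rightarrow> ('j \<Rightarrow> real) set \<Rightarrow> (('i \<Rightarrow> real) \<Rightarrow> 'j \<Rightarrow> real) \<Rightarrow> bool" where
  "real_analytic_diffeomorphism I H U J K V f \<longleftrightarrow>
     openin (subtopology (product_topology (\<lambda>_. euclideanreal) I) H) U \<and>
     openin (subtopology (product_topology (\<lambda>_. euclideanreal) J) K) V \<and>
     bij_betw f U V \<and>
     (\<forall>j\<in>J. real_analytic_on I U (\<lambda>x. f x j)) \<and>
     (\<forall>i\<in>I. real_analytic_on J V (\<lambda>y. inv_into U f y i))"

definition sum_one_hyperplane :: "nat \<Rightarrow> (nat \<Rightarrow> real) set" where
  "sum_one_hyperplane N = {y \<in> {1..N} \<rightarrow>\<^sub>E UNIV. (\<Sum>i\<in>{1..N}. y i) = 1}"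

definition open_simplex :: "nat \<Rightarrow> (nat \<Rightarrow> real) set" where
  "open_simplex N = {y \<in> {1..N} \<rightarrow>\<^sub>E {0<..<1}. (\<Sum>i\<in>{1..N}. y i) = 1}"

definition interlacing_box :: "nat \<Rightarrow> (nat \<Rightarrow> real) \<Rightarrow> (nat \<Rightarrow> real) set" where
  "interlacing_box N g = (\<Pi>\<^sub>E j\<in>{1..<N}. {g j<..<g (j + 1)})"

definition m_fun :: "nat \<Rightarrow> (nat \<Rightarrow> real) \<Rightarrow> (nat \<Rightarrow> real) \<Rightarrow> real \<Rightarrow> real" where
  "m_fun N g y z = (\<Sum>i\<in>{1..N}. y i / (g i - z))"

definition zero_map :: "nat \<Rightarrow> (nat \<Rightarrow> real) \<Rightarrow> (nat \<Rightarrow> real) \<Rightarrow> (nat \<Rightarrow> real)" where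
  "zero_map N g y = (\<lambda>j\<in>{1..<N}. THE z. z \<in> {g j<..<g (j + 1)} \<and> m_fun N g y z = 0)"

end

theory Submission
  imports Defs "HOL-Complex_Analysis.Complex_Analysis"
begin

text \<open>
  For \<open>\<Sum>y\<^sub>i = 1\<close>, clearing denominators turns \<open>m\<^sub>y\<close> into \<open>\<Prod>\<^sub>j(z\<^sub>j - s) / \<Prod>\<^sub>i(g\<^sub>i - s)\<close>: both numerators are
  polynomials of degree at most \<open>N - 1\<close> with the same top coefficient and the same \<open>N - 1\<close> roots.
  Evaluating at the nodes \<open>g\<^sub>i\<close> gives the inverse map, and reading the identity backwards
  (Lagrange interpolation) gives surjectivity onto the box.

  For the analyticity of \<open>z\<^sub>j\<close> near \<open>a\<close>, put \<open>w = z(a)\<close> and \<open>u = (m\<^sub>y - m\<^sub>a) / m\<^sub>a\<close>, which is linear in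
  \<open>y - a\<close>. Since \<open>1 + u = \<Prod>\<^sub>l(z\<^sub>l - s) / (w\<^sub>l - s)\<close>, the argument principle and integration by parts on
  a small circle about \<open>w\<^sub>j\<close> yield \<open>z\<^sub>j - w\<^sub>j = - (1 / 2\<pi>\<i>) \<oint> ln (1 + u(s)) ds\<close>. Expanding the logarithm
  in powers of \<open>u\<close> gives a convergent power series in \<open>y - a\<close> with explicit coefficients.
\<close>

section \<open>Multivariate power series from words\<close>

definition words :: "'i set \<Rightarrow> nat \<Rightarrow> 'i list set" where
  "words I k = {xs. set xs \<subseteq> I \<and> length xs = k}"

lemma finite_words: "finite I \<Longrightarrow> finite (words I k)"
  unfolding words_def by (rule finite_lists_length_eq)

lemma words_0: "words I 0 = {[]}"
  by (auto simp: words_def)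

text \<open>Multiplying out the power without commuting any factors produces each word exactly once,
  always with coefficient 1.\<close>

lemma sum_words_prod_list:
  fixes v :: "'i \<Rightarrow> 'a::comm_semiring_1"
  shows "(\<Sum>xs\<in>words I k. prod_list (map v xs)) = (\<Sum>i\<in>I. v i) ^ k"
proof (induction k)
  case 0
  then show ?case by (simp add: words_0)
next
  case (Suc k)
  have "(\<Sum>xs\<in>words I (Suc k). prod_list (map v xs))
      = (\<Sum>(xs, i)\<in>words I k \<times> I. prod_list (map v (i # xs)))"
    unfolding words_def lists_length_Suc_eq
    by (subst sum.reindex) (auto simp: inj_on_def case_prod_unfold)
  also have "\<dots> = (\<Sum>xs\<in>words I k. \<Sum>i\<in>I. v i * prod_list (map v xs))"
    by (simp add: sum.cartesian_product)
  also have "\<dots> = (\<Sum>i\<in>I. v i) * (\<Sum>xs\<in>words I k. prod_list (map v xs))"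
    by (simp add: sum_distrib_left sum_distrib_right)
  finally show ?case using Suc.IH by simp
qed

lemma prod_list_map_eq_prod_count_list:
  fixes h :: "'i \<Rightarrow> 'a::comm_monoid_mult"
  assumes "finite I" "set xs \<subseteq> I"
  shows "prod_list (map h xs) = (\<Prod>i\<in>I. h i ^ count_list xs i)"
  using assms(2)
proof (induction xs)
  case (Cons x xs)
  have "(\<Prod>i\<in>I. h i ^ count_list (x # xs) i)
      = (\<Prod>i\<in>I. (if i = x then h i else 1) * h i ^ count_list xs i)"
    by (intro prod.cong) auto
  also have "\<dots> = h x * (\<Prod>i\<in>I. h i ^ count_list xs i)"
    using Cons.prems assms(1) by (simp add: prod.distrib)
  finally show ?case using Cons by simp
qed simp

lemma length_eq_sum_count_list:
  assumes "finite I" "set xs \<subseteq> I"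
  shows "length xs = (\<Sum>i\<in>I. count_list xs i)"
  using sum_count_set[OF assms(2,1)] by simp

text \<open>
  A power series in noncommuting variables, grouped by letter counts, becomes an ordinary
  multivariate power series; this avoids multinomial coefficients.
\<close>

lemma real_analytic_onI_words:
  fixes U :: "('i \<Rightarrow> real) set"
  assumes I: "finite I"
    and *: "\<And>a. a \<in> U \<Longrightarrow> \<exists>r>0. \<exists>C B D. 0 \<le> D \<and> real (card I) * r * D < 1 \<and>
         (\<forall>xs. set xs \<subseteq> I \<longrightarrow> \<bar>C xs\<bar> \<le> B * D ^ length xs) \<and>
         (\<forall>x\<in>U. (\<forall>i\<in>I. \<bar>x i - a i\<bar> < r) \<longrightarrow>
            (\<lambda>k. \<Sum>xs\<in>words I k. C xs * prod_list (map (\<lambda>i. x i - a i) xs)) sums f x)"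
  shows "real_analytic_on I U f"
  unfolding real_analytic_on_def
proof
  fix a assume "a \<in> U"
  from *[OF this] obtain r C B D where r: "r > 0" and D: "0 \<le> D" "real (card I) * r * D < 1"
    and C: "\<forall>xs. set xs \<subseteq> I \<longrightarrow> \<bar>C xs\<bar> \<le> B * D ^ length xs"
    and f: "\<forall>x\<in>U. (\<forall>i\<in>I. \<bar>x i - a i\<bar> < r) \<longrightarrow>
            (\<lambda>k. \<Sum>xs\<in>words I k. C xs * prod_list (map (\<lambda>i. x i - a i) xs)) sums f x"
    by blast
  \<comment> \<open>\<open>M \<alpha>\<close> collects the words that become the monomial with
    exponent \<open>\<alpha>\<close> once the letters commute; \<open>restrict\<close> makes the
    letter counts an extensional multi-index.\<close>
  define M where "M \<alpha> = {xs. set xs \<subseteq> I \<and> restrict (count_list xs) I = \<alpha>}" for \<alpha>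
  define c where "c \<alpha> = sum C (M \<alpha>)" for \<alpha>
  \<comment> \<open>The multi-index fixes the word length, namely the sum of its entries.\<close>
  have finM: "finite (M \<alpha>)" for \<alpha>
  proof (rule finite_subset)
    show "M \<alpha> \<subseteq> words I (\<Sum>i\<in>I. \<alpha> i)"
      unfolding M_def words_def using length_eq_sum_count_list[OF I] by auto
  qed (rule finite_words[OF I])
  have Mmon: "prod_list (map (\<lambda>i. x i - a i) xs) = monomial_at I a x \<alpha>" if "xs \<in> M \<alpha>" for x xs \<alpha>
    using that unfolding monomial_at_def M_def
    by (auto simp: prod_list_map_eq_prod_count_list[OF I])
  have B0: "0 \<le> B" using spec[OF C, of "[]"] by auto
  have summ: "(\<lambda>(k, xs). C xs * prod_list (map (\<lambda>i. x i - a i) xs)) summable_on Sigma UNIV (words I)"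
    if x: "\<And>i. i \<in> I \<Longrightarrow> \<bar>x i - a i\<bar> < r" for x
  proof (rule Infinite_Sum.abs_summable_summable, rule Infinite_Sum.abs_summable_on_Sigma_iff[THEN iffD2], intro conjI ballI)
    define T where "T xs = C xs * prod_list (map (\<lambda>i. x i - a i) xs)" for xs
    define s where "s = (\<Sum>i\<in>I. \<bar>x i - a i\<bar>)"
    have s: "0 \<le> s" "s \<le> card I * r"
      unfolding s_def using sum_mono[of I "\<lambda>i. \<bar>x i - a i\<bar>" "\<lambda>_. r"] x by (auto intro: sum_nonneg less_imp_le)
    have sD: "0 \<le> D * s" "D * s < 1"
      using s D mult_left_mono[OF s(2) D(1)] by (auto simp: mult_ac)
    \<comment> \<open>The absolute monomials of length \<open>k\<close> add up to
      \<open>s ^ k\<close>, so the blocks are dominated by a geometric series whose ratio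
      \<open>D * s\<close> is at most \<open>card I * r * D\<close>.\<close>
    have bound: "(\<Sum>xs\<in>words I k. \<bar>T xs\<bar>) \<le> B * (D * s) ^ k" for k
    proof -
      have "(\<Sum>xs\<in>words I k. \<bar>T xs\<bar>)
          \<le> (\<Sum>xs\<in>words I k. B * D ^ k * prod_list (map (\<lambda>i. \<bar>x i - a i\<bar>) xs))"
      proof (rule sum_mono)
        fix xs assume xs: "xs \<in> words I k"
        have "\<bar>prod_list (map h xs)\<bar> = prod_list (map (\<lambda>i. \<bar>h i\<bar>) xs)" for h :: "'i \<Rightarrow> real"
          by (induction xs) (auto simp: abs_mult)
        moreover have "0 \<le> prod_list (map (\<lambda>i. \<bar>x i - a i\<bar>) xs)"
          by (induction xs) auto
        ultimately show "\<bar>T xs\<bar> \<le> B * D ^ k * prod_list (map (\<lambda>i. \<bar>x i - a i\<bar>) xs)"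
          unfolding T_def abs_mult using spec[OF C, of xs] xs
          by (auto simp: words_def intro!: mult_right_mono)
      qed
      also have "\<dots> = B * (D * s) ^ k"
        by (simp add: sum_distrib_left[symmetric] sum_words_prod_list s_def power_mult_distrib)
      finally show ?thesis .
    qed
    have "summable (\<lambda>k. B * (D * s) ^ k)"
      using sD by (intro summable_mult summable_geometric) simp
    then have "summable (\<lambda>k. norm (\<Sum>xs\<in>words I k. \<bar>T xs\<bar>))"
      by (rule summable_comparison_test') (use bound in \<open>simp add: sum_nonneg\<close>)
    then have "(\<lambda>k. norm (\<Sum>xs\<in>words I k. \<bar>T xs\<bar>)) summable_on UNIV"
      by (intro norm_summable_imp_summable_on) simp
    then show "(\<lambda>k. norm (\<Sum>\<^sub>\<infinity>xs\<in>words I k. norm (case (k, xs) of (k, xs) \<Rightarrow>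
        C xs * prod_list (map (\<lambda>i. x i - a i) xs)))) summable_on UNIV"
      by (simp add: finite_words[OF I] T_def)
  qed (simp add: finite_words[OF I])
  \<comment> \<open>The same words sorted in two ways, by letter counts and by length; absolute
    summability permits changing from one to the other.\<close>
  have bij: "bij_betw (\<lambda>(\<alpha>, xs). (length xs, xs)) (Sigma (I \<rightarrow>\<^sub>E UNIV) M) (Sigma UNIV (words I))"
    by (rule bij_betw_byWitness[where f' = "\<lambda>(k, xs). (restrict (count_list xs) I, xs)"])
       (auto simp: M_def words_def)
  have series: "((\<lambda>\<alpha>. c \<alpha> * monomial_at I a x \<alpha>) has_sum
        (\<Sum>\<^sub>\<infinity>(k, xs)\<in>Sigma UNIV (words I). C xs * prod_list (map (\<lambda>i. x i - a i) xs))) (I \<rightarrow>\<^sub>E UNIV)"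
    (is "(_ has_sum ?S) _")
    if x: "\<And>i. i \<in> I \<Longrightarrow> \<bar>x i - a i\<bar> < r" for x
  proof (rule has_sum_SigmaD)
    have "((\<lambda>(k, xs). C xs * prod_list (map (\<lambda>i. x i - a i) xs)) has_sum ?S) (Sigma UNIV (words I))"
      by (rule has_sum_infsum[OF summ[OF x]])
    then show "((\<lambda>(\<alpha>, xs). C xs * prod_list (map (\<lambda>i. x i - a i) xs)) has_sum ?S) (Sigma (I \<rightarrow>\<^sub>E UNIV) M)"
      by (subst (asm) has_sum_reindex_bij_betw[OF bij, symmetric]) (simp add: case_prod_unfold)
    fix \<alpha>
    have "c \<alpha> * monomial_at I a x \<alpha> = (\<Sum>xs\<in>M \<alpha>. C xs * prod_list (map (\<lambda>i. x i - a i) xs))"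
      unfolding c_def by (simp add: sum_distrib_right Mmon)
    then show "((\<lambda>xs. case (\<alpha>, xs) of (\<alpha>, xs) \<Rightarrow> C xs * prod_list (map (\<lambda>i. x i - a i) xs))
        has_sum c \<alpha> * monomial_at I a x \<alpha>) (M \<alpha>)"
      using has_sum_finite[OF finM] by simp
  qed
  \<comment> \<open>Convergence holds on the whole cube around \<open>a\<close>, but the value of
    the sum is known only on \<open>U\<close>.\<close>
  have sum_eq: "(\<Sum>\<^sub>\<infinity>(k, xs)\<in>Sigma UNIV (words I). C xs * prod_list (map (\<lambda>i. x i - a i) xs)) = f x"
    if "x \<in> U" and x: "\<And>i. i \<in> I \<Longrightarrow> \<bar>x i - a i\<bar> < r" for x
  proof -
    have "((\<lambda>k. \<Sum>xs\<in>words I k. C xs * prod_list (map (\<lambda>i. x i - a i) xs)) has_sum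
      (\<Sum>\<^sub>\<infinity>(k, xs)\<in>Sigma UNIV (words I). C xs * prod_list (map (\<lambda>i. x i - a i) xs))) UNIV"
      by (rule has_sum_SigmaD[OF has_sum_infsum[OF summ[OF x]]]) (simp_all add: finite_words[OF I])
    then show ?thesis
      using bspec[OF f that(1)] x has_sum_imp_sums sums_unique2 by blast
  qed
  show "\<exists>r>0. \<exists>c. (\<forall>x\<in>I \<rightarrow>\<^sub>E UNIV. (\<forall>i\<in>I. \<bar>x i - a i\<bar> < r) \<longrightarrow>
            (\<lambda>\<alpha>. c \<alpha> * monomial_at I a x \<alpha>) summable_on (I \<rightarrow>\<^sub>E UNIV)) \<and>
         (\<forall>x\<in>U. (\<forall>i\<in>I. \<bar>x i - a i\<bar> < r) \<longrightarrow>
            ((\<lambda>\<alpha>. c \<alpha> * monomial_at I a x \<alpha>) has_sum f x) (I \<rightarrow>\<^sub>E UNIV))"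
  proof (rule exI[of _ r], intro conjI[OF r] exI[of _ c] conjI ballI impI)
    fix x assume "\<forall>i\<in>I. \<bar>x i - a i\<bar> < r"
    then show "(\<lambda>\<alpha>. c \<alpha> * monomial_at I a x \<alpha>) summable_on (I \<rightarrow>\<^sub>E UNIV)"
      using series has_sum_imp_summable by blast
  next
    fix x assume "x \<in> U" "\<forall>i\<in>I. \<bar>x i - a i\<bar> < r"
    then show "((\<lambda>\<alpha>. c \<alpha> * monomial_at I a x \<alpha>) has_sum f x) (I \<rightarrow>\<^sub>E UNIV)"
      using series[of x] sum_eq[of x] by simp
  qed
qed

text \<open>Every factor is affine: \<open>b i - x i = (b i - a i) - (x i - a i)\<close>. The
  expansion about \<open>a\<close> is therefore finite, with exponents 0 and 1 only, and any radius
  serves. This covers the inverse map.\<close>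

lemma real_analytic_on_prod_diff:
  fixes b :: "'i \<Rightarrow> real"
  assumes I: "finite I"
  shows "real_analytic_on I U (\<lambda>x. K * (\<Prod>i\<in>I. b i - x i))"
  unfolding real_analytic_on_def
proof
  fix a
  define e where "e i n = (if n = 0 then b i - a i else -1)" for i and n :: nat
  define c where "c \<alpha> = (if \<alpha> \<in> I \<rightarrow>\<^sub>E {0,1} then K * (\<Prod>i\<in>I. e i (\<alpha> i)) else 0)" for \<alpha>
  have hs: "((\<lambda>\<alpha>. c \<alpha> * monomial_at I a x \<alpha>) has_sum K * (\<Prod>i\<in>I. b i - x i)) (I \<rightarrow>\<^sub>E UNIV)" for x
  proof -
    have "(\<Prod>i\<in>I. b i - x i) = (\<Prod>i\<in>I. \<Sum>n\<in>{0,1}. e i n * (x i - a i) ^ n)"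
      by (simp add: e_def)
    also have "\<dots> = (\<Sum>\<alpha>\<in>I \<rightarrow>\<^sub>E {0,1}. \<Prod>i\<in>I. e i (\<alpha> i) * (x i - a i) ^ \<alpha> i)"
      using I by (subst prod_sum_PiE) auto
    finally have "K * (\<Prod>i\<in>I. b i - x i) = (\<Sum>\<alpha>\<in>I \<rightarrow>\<^sub>E {0,1}. c \<alpha> * monomial_at I a x \<alpha>)"
      by (simp add: c_def sum_distrib_left prod.distrib monomial_at_def mult_ac)
    moreover have "((\<lambda>\<alpha>. c \<alpha> * monomial_at I a x \<alpha>) has_sum
        (\<Sum>\<alpha>\<in>I \<rightarrow>\<^sub>E {0,1}. c \<alpha> * monomial_at I a x \<alpha>)) (I \<rightarrow>\<^sub>E {0,1})"
      using I by (intro has_sum_finite finite_PiE) auto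
    ultimately show ?thesis
      by (subst has_sum_cong_neutral[where T = "I \<rightarrow>\<^sub>E {0,1}"]) (auto simp: c_def)
  qed
  then show "\<exists>r>0. \<exists>c. (\<forall>x\<in>I \<rightarrow>\<^sub>E UNIV. (\<forall>i\<in>I. \<bar>x i - a i\<bar> < r) \<longrightarrow>
            (\<lambda>\<alpha>. c \<alpha> * monomial_at I a x \<alpha>) summable_on (I \<rightarrow>\<^sub>E UNIV)) \<and>
         (\<forall>x\<in>U. (\<forall>i\<in>I. \<bar>x i - a i\<bar> < r) \<longrightarrow>
            ((\<lambda>\<alpha>. c \<alpha> * monomial_at I a x \<alpha>) has_sum K * (\<Prod>i\<in>I. b i - x i)) (I \<rightarrow>\<^sub>E UNIV))"
    by (intro exI[of _ 1] exI[of _ c] conjI ballI impI zero_less_one has_sum_imp_summable[OF hs] hs)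
qed

section \<open>Partial fractions and interlacing zeros\<close>

text \<open>The factors are \<open>z j - X\<close>, matching the denominators of
  \<open>m_fun\<close>, which makes the leading coefficient a power of -1. The field stays arbitrary
  because both real and complex instances occur.\<close>

definition nodal :: "('j \<Rightarrow> 'a::field) \<Rightarrow> 'j set \<Rightarrow> 'a poly" where
  "nodal z J = (\<Prod>j\<in>J. [:z j, -1:])"

text \<open>The numerator of the sum of \<open>y i / (g i - X)\<close> over the common denominator
  \<open>nodal g I\<close>.\<close>

definition weighted_nodal :: "('i \<Rightarrow> 'a::field) \<Rightarrow> 'i set \<Rightarrow> ('i \<Rightarrow> 'a) \<Rightarrow> 'a poly" where
  "weighted_nodal g I y = (\<Sum>i\<in>I. smult (y i) (nodal g (I - {i})))"

lemma poly_nodal: "poly (nodal z J) x = (\<Prod>j\<in>J. z j - x)"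
  by (simp add: nodal_def poly_prod)

lemma degree_nodal: "degree (nodal z J) = card J"
  by (simp add: nodal_def degree_prod_sum_eq)

lemma coeff_nodal_card: "coeff (nodal z J) (card J) = (-1) ^ card J"
proof -
  have "lead_coeff (nodal z J) = (-1) ^ card J"
    unfolding nodal_def by (subst lead_coeff_prod) simp
  then show ?thesis by (simp add: degree_nodal)
qed

lemma
  assumes "finite I" "card I = Suc n"
  shows degree_weighted_nodal_le: "degree (weighted_nodal g I y) \<le> n"
    and coeff_weighted_nodal: "coeff (weighted_nodal g I y) n = (-1) ^ n * (\<Sum>i\<in>I. y i)"
proof -
  have card: "card (I - {i}) = n" if "i \<in> I" for i
    using assms that by simp
  show "degree (weighted_nodal g I y) \<le> n"
    unfolding weighted_nodal_def
    by (intro degree_sum_le assms) (metis card degree_nodal degree_smult_le)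
  have "coeff (nodal g (I - {i})) n = (-1) ^ n" if "i \<in> I" for i
    using coeff_nodal_card[of g "I - {i}"] card[OF that] by simp
  then show "coeff (weighted_nodal g I y) n = (-1) ^ n * (\<Sum>i\<in>I. y i)"
    by (simp add: weighted_nodal_def coeff_sum mult.commute flip: sum_distrib_right)
qed

lemma poly_weighted_nodal_node:
  assumes "finite I" "i \<in> I"
  shows "poly (weighted_nodal g I y) (g i) = y i * (\<Prod>m\<in>I - {i}. g m - g i)"
proof -
  have "poly (weighted_nodal g I y) (g i) = (\<Sum>k\<in>I. y k * (\<Prod>m\<in>I - {k}. g m - g i))"
    by (simp add: weighted_nodal_def poly_sum poly_nodal)
  also have "\<dots> = (\<Sum>k\<in>I. if k = i then y i * (\<Prod>m\<in>I - {i}. g m - g i) else 0)"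
    using assms by (intro sum.cong) (auto intro!: prod_zero)
  also have "\<dots> = y i * (\<Prod>m\<in>I - {i}. g m - g i)"
    using assms by simp
  finally show ?thesis .
qed

lemma poly_weighted_nodal:
  assumes "finite I" "x \<notin> g ` I"
  shows "poly (weighted_nodal g I y) x = (\<Sum>i\<in>I. y i / (g i - x)) * (\<Prod>i\<in>I. g i - x)"
proof -
  have "(\<Prod>m\<in>I - {i}. g m - x) = (\<Prod>m\<in>I. g m - x) / (g i - x)" if "i \<in> I" for i
    using assms that by (subst prod.remove[OF assms(1) that]) auto
  then show ?thesis
    by (simp add: weighted_nodal_def poly_sum poly_nodal sum_distrib_right)
qed

text \<open>Weights of sum 1 make the top coefficients agree, so the difference has too small a
  degree to vanish at \<open>card J\<close> distinct points without being zero.\<close>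

lemma weighted_nodal_eq_nodal_of_roots:
  assumes "finite I" "finite J" "card I = Suc (card J)" "inj_on z J" "(\<Sum>i\<in>I. y i) = 1"
    and "\<And>j. j \<in> J \<Longrightarrow> poly (weighted_nodal g I y) (z j) = 0"
  shows "weighted_nodal g I y = nodal z J"
proof (rule poly_eqI_degree_lead_coeff[where n = "card J" and A = "z ` J"])
  show "card J \<le> card (z ` J)" using assms(4) by (simp add: card_image)
  show "coeff (weighted_nodal g I y) (card J) = coeff (nodal z J) (card J)"
    using assms(1,3,5) by (simp add: coeff_weighted_nodal coeff_nodal_card)
next
  fix x assume "x \<in> z ` J"
  then show "poly (weighted_nodal g I y) x = poly (nodal z J) x"
    using assms(2,6) by (auto simp: poly_nodal)
qed (use assms degree_weighted_nodal_le in \<open>auto simp: degree_nodal\<close>)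

text \<open>Polynomials of degree at most \<open>card J\<close> are determined by their values at
  the \<open>card J + 1\<close> nodes, and at \<open>g i\<close> only the term with weight
  \<open>y i\<close> survives. Read one way this gives the inverse formula, read the other way
  surjectivity.\<close>

lemma weighted_nodal_eq_nodal_iff:
  assumes "finite I" "card I = Suc (card J)" "inj_on g I"
  shows "weighted_nodal g I y = nodal z J \<longleftrightarrow>
    (\<forall>i\<in>I. y i = (\<Prod>j\<in>J. g i - z j) / (\<Prod>m\<in>I - {i}. g i - g m))"
proof -
  have "y i = (\<Prod>j\<in>J. g i - z j) / (\<Prod>m\<in>I - {i}. g i - g m) \<longleftrightarrow>
      poly (weighted_nodal g I y) (g i) = poly (nodal z J) (g i)" if i: "i \<in> I" for i
  proof -
    have "(\<Prod>m\<in>I - {i}. g m - g i) \<noteq> 0"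
      using assms i by (auto simp: inj_on_def)
    \<comment> \<open>Numerator and denominator have equally many factors, so the signs from
      reversing all differences cancel.\<close>
    moreover have "card (I - {i}) = card J"
      using assms i by simp
    moreover have "(\<Prod>m\<in>I - {i}. g i - g m) = (-1) ^ card (I - {i}) * (\<Prod>m\<in>I - {i}. g m - g i)"
      using prod_uminus[of "\<lambda>m. g m - g i" "I - {i}"] by simp
    moreover have "(\<Prod>j\<in>J. g i - z j) = (-1) ^ card J * (\<Prod>j\<in>J. z j - g i)"
      using prod_uminus[of "\<lambda>j. z j - g i" J] by simp
    ultimately show ?thesis
      by (simp add: poly_weighted_nodal_node[OF assms(1) i] poly_nodal nonzero_eq_divide_eq)
  qed
  moreover have "weighted_nodal g I y = nodal z J \<longleftrightarrow>
      (\<forall>i\<in>I. poly (weighted_nodal g I y) (g i) = poly (nodal z J) (g i))"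
  proof
    assume *: "\<forall>i\<in>I. poly (weighted_nodal g I y) (g i) = poly (nodal z J) (g i)"
    have "card (g ` I) = Suc (card J)"
      using assms by (simp add: card_image)
    then show "weighted_nodal g I y = nodal z J"
      using * degree_weighted_nodal_le[OF assms(1,2)]
      by (intro poly_eqI_degree[where A = "g ` I"]) (auto simp: degree_nodal less_Suc_eq_le)
  qed simp
  ultimately show ?thesis by blast
qed

text \<open>The candidate inverse of \<open>zero_map\<close>, made extensional so that it can be
  compared with points of the simplex as a function.\<close>

definition lagrange_weights :: "nat \<Rightarrow> (nat \<Rightarrow> real) \<Rightarrow> (nat \<Rightarrow> real) \<Rightarrow> nat \<Rightarrow> real" where
  "lagrange_weights N g z =
     (\<lambda>i\<in>{1..N}. (\<Prod>j\<in>{1..<N}. g i - z j) / (\<Prod>m\<in>{1..N} - {i}. g i - g m))"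

section \<open>Zeros of \<open>m_fun\<close> in the gaps between nodes\<close>

locale interlacing =
  fixes N :: nat and g :: "nat \<Rightarrow> real"
  assumes N: "N \<ge> 2" and mono: "strict_mono_on {1..N} g"
begin

lemma g_less: "i < m \<Longrightarrow> 1 \<le> i \<Longrightarrow> m \<le> N \<Longrightarrow> g i < g m"
  using mono by (auto simp: strict_mono_on_def)

lemma g_le: "i \<le> m \<Longrightarrow> 1 \<le> i \<Longrightarrow> m \<le> N \<Longrightarrow> g i \<le> g m"
  using g_less[of i m] by (cases "i = m") auto

lemma inj_g: "inj_on g {1..N}"
  using mono by (rule strict_mono_on_imp_inj_on)

lemma card_N: "card {1..N} = Suc (card {1..<N})"
  using N by simp

lemma node_below:
  assumes "j \<in> {1..<N}" "t > g j" "i \<in> {1..N}" "i \<le> j"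
  shows "g i < t"
  using g_le[of i j] assms by auto

lemma node_above:
  assumes "j \<in> {1..<N}" "t < g (j + 1)" "i \<in> {1..N}" "j < i"
  shows "t < g i"
  using g_le[of "j + 1" i] assms by auto

lemma node_neq:
  assumes "j \<in> {1..<N}" "t \<in> {g j<..<g (j + 1)}" "i \<in> {1..N}"
  shows "g i \<noteq> t"
  using node_below[of j t i] node_above[of j t i] assms by (cases "i \<le> j") auto

lemma disjoint_gaps:
  assumes "j \<in> {1..<N}" "t \<in> {g j<..<g (j + 1)}" "l \<in> {1..<N}" "t \<in> {g l<..<g (l + 1)}"
  shows "j = l"
  using node_below[of j t "l + 1"] node_below[of l t "j + 1"] assms
  by (cases j l rule: linorder_cases) auto

lemma inj_box: "z \<in> interlacing_box N g \<Longrightarrow> inj_on z {1..<N}"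
  by (rule inj_onI) (metis (no_types, lifting) disjoint_gaps PiE_mem interlacing_box_def)

lemma open_simplexD:
  assumes "y \<in> open_simplex N"
  shows "\<And>i. i \<in> {1..N} \<Longrightarrow> 0 < y i" "(\<Sum>i\<in>{1..N}. y i) = 1" "y \<in> extensional {1..N}"
  using assms by (auto simp: open_simplex_def PiE_def)

text \<open>Within a gap no denominator \<open>g i - t\<close> changes sign, so every summand
  increases strictly because its weight is positive.\<close>

lemma m_fun_less:
  assumes y: "y \<in> open_simplex N" and j: "j \<in> {1..<N}"
    and "t \<in> {g j<..<g (j + 1)}" "t' \<in> {g j<..<g (j + 1)}" "t < t'"
  shows "m_fun N g y t < m_fun N g y t'"
  unfolding m_fun_def
proof (rule sum_strict_mono)
  fix i assume i: "i \<in> {1..N}"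
  have "(g i - t) * (g i - t') > 0"
    using node_below[OF j _ i, of t] node_below[OF j _ i, of t'] node_above[OF j _ i, of t]
      node_above[OF j _ i, of t'] assms(3,4)
    by (cases "i \<le> j") (auto intro: mult_pos_pos mult_neg_neg)
  then show "y i / (g i - t) < y i / (g i - t')"
    using assms(5) open_simplexD(1)[OF y i] by (intro divide_strict_left_mono) (auto simp: mult.commute)
qed (use N in auto)

lemma m_fun_zero_unique:
  assumes "y \<in> open_simplex N" "j \<in> {1..<N}"
    and "t \<in> {g j<..<g (j + 1)}" "t' \<in> {g j<..<g (j + 1)}"
    and "m_fun N g y t = 0" "m_fun N g y t' = 0"
  shows "t = t'"
  using m_fun_less[of y j t t'] m_fun_less[of y j t' t] assms by (cases t t' rule: linorder_cases) auto

text \<open>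
  Multiplying \<open>m_fun\<close> by \<open>(g j - t) * (g (j + 1) - t)\<close> removes the two poles at the ends of the
  gap, so the intermediate value theorem applies on the closed interval.
\<close>

lemma m_fun_zero_exists:
  assumes y: "y \<in> open_simplex N" and j: "j \<in> {1..<N}"
  shows "\<exists>t\<in>{g j<..<g (j + 1)}. m_fun N g y t = 0"
proof -
  define I where "I = {1..N} - {j, j + 1}"
  define F where "F t = y j * (g (j + 1) - t) + y (j + 1) * (g j - t)
    + (g j - t) * (g (j + 1) - t) * (\<Sum>i\<in>I. y i / (g i - t))" for t
  have lt: "g j < g (j + 1)" using j by (intro g_less) auto
  \<comment> \<open>The remaining nodes lie outside the closed gap, so \<open>F\<close> is
    continuous up to its ends.\<close>
  have ne: "g i - t \<noteq> 0" if "i \<in> I" "t \<in> {g j..g (j + 1)}" for i t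
    using that j g_less[of i j] g_less[of "j + 1" i]
    by (cases i j rule: linorder_cases) (auto simp: I_def)
  have "continuous_on {g j..g (j + 1)} F"
    unfolding F_def by (intro continuous_intros ballI ne)
  \<comment> \<open>At each end a single term survives:
    \<open>F (g j) = y j * (g (j + 1) - g j)\<close> and
    \<open>F (g (j + 1)) = y (j + 1) * (g j - g (j + 1))\<close>. The signs are opposite and strict,
    so the zero is interior.\<close>
  moreover have "F (g (j + 1)) \<le> 0" "0 \<le> F (g j)" 
    using lt open_simplexD(1)[OF y, of j] open_simplexD(1)[OF y, of "j + 1"] j by (auto simp: F_def mult_le_0_iff zero_le_mult_iff)
  moreover have F0: "F (g (j + 1)) \<noteq> 0" "F (g j) \<noteq> 0"
    using lt open_simplexD(1)[OF y, of j] open_simplexD(1)[OF y, of "j + 1"] j by (auto simp: F_def)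
  ultimately obtain t where t: "g j \<le> t" "t \<le> g (j + 1)" "F t = 0"
    using IVT2'[of F "g (j + 1)" 0 "g j"] lt by auto
  then have t': "t \<in> {g j<..<g (j + 1)}"
    using F0 by (cases "t = g j \<or> t = g (j + 1)") auto
  have "m_fun N g y t = y j / (g j - t) + (y (j + 1) / (g (j + 1) - t) + (\<Sum>i\<in>I. y i / (g i - t)))"
  proof -
    have "{1..N} = insert j (insert (j + 1) I)" using j by (auto simp: I_def)
    moreover have "finite I" "j \<notin> I" "j + 1 \<notin> I" by (auto simp: I_def)
    ultimately show ?thesis
      unfolding m_fun_def by simp
  qed
  moreover have clear_poles: "(a / u + (b / v + S)) * (u * v) = a * v + b * u + u * v * S"
    if "u \<noteq> 0" "v \<noteq> 0" for a b u v S :: real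
    using that by (simp add: field_simps)
  ultimately have "m_fun N g y t * ((g j - t) * (g (j + 1) - t)) = F t"
    using t' clear_poles[of "g j - t" "g (j + 1) - t"] by (simp add: F_def)
  then have "m_fun N g y t = 0" using t t' by auto
  then show ?thesis using t' by blast
qed

lemma m_fun_ex1_zero:
  assumes "y \<in> open_simplex N" "j \<in> {1..<N}"
  shows "\<exists>!t. t \<in> {g j<..<g (j + 1)} \<and> m_fun N g y t = 0"
  using m_fun_zero_exists[of y j] m_fun_zero_unique[of y j] assms by blast

lemma zero_map:
  assumes "y \<in> open_simplex N"
  shows zero_map_in_box: "zero_map N g y \<in> interlacing_box N g"
    and m_fun_zero_map: "\<And>j. j \<in> {1..<N} \<Longrightarrow> m_fun N g y (zero_map N g y j) = 0"
  using theI'[OF m_fun_ex1_zero[OF assms]] by (auto simp: zero_map_def interlacing_box_def)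

lemma box_gap: "z \<in> interlacing_box N g \<Longrightarrow> j \<in> {1..<N} \<Longrightarrow> z j \<in> {g j<..<g (j + 1)}"
  by (auto simp: interlacing_box_def)

lemma zero_map_eqI:
  assumes "y \<in> open_simplex N" "z \<in> interlacing_box N g"
    and "\<And>j. j \<in> {1..<N} \<Longrightarrow> m_fun N g y (z j) = 0"
  shows "zero_map N g y = z"
proof (rule PiE_ext)
  show "zero_map N g y \<in> (\<Pi>\<^sub>E j\<in>{1..<N}. {g j<..<g (j + 1)})" "z \<in> (\<Pi>\<^sub>E j\<in>{1..<N}. {g j<..<g (j + 1)})"
    using assms(2) zero_map_in_box[OF assms(1)] by (auto simp: interlacing_box_def)
  fix j assume j: "j \<in> {1..<N}"
  show "zero_map N g y j = z j"
    using assms(1) j box_gap[OF zero_map_in_box[OF assms(1)] j]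
      box_gap[OF assms(2) j] m_fun_zero_map[OF assms(1) j] assms(3)[OF j]
    by (rule m_fun_zero_unique)
qed

section \<open>Inversion by Lagrange interpolation\<close>

lemma weighted_nodal_zero_map:
  assumes "y \<in> open_simplex N"
  shows "weighted_nodal g {1..N} y = nodal (zero_map N g y) {1..<N}"
proof (rule weighted_nodal_eq_nodal_of_roots)
  fix j assume j: "j \<in> {1..<N}"
  \<comment> \<open>The zeros avoid the nodes, so a zero of \<open>m_fun\<close> is a root of the
    polynomial obtained by clearing denominators.\<close>
  have "zero_map N g y j \<notin> g ` {1..N}"
    using node_neq[OF j box_gap[OF zero_map_in_box[OF assms] j]] by force
  then show "poly (weighted_nodal g {1..N} y) (zero_map N g y j) = 0"
    using m_fun_zero_map[OF assms j] by (simp add: poly_weighted_nodal m_fun_def)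
qed (use assms card_N inj_box zero_map_in_box open_simplexD in auto)

lemma lagrange_weights_zero_map:
  assumes "y \<in> open_simplex N"
  shows "lagrange_weights N g (zero_map N g y) = y"
  using weighted_nodal_zero_map[OF assms] open_simplexD(3)[OF assms]
  unfolding weighted_nodal_eq_nodal_iff[OF finite_atLeastAtMost card_N inj_g]
  by (auto simp: lagrange_weights_def fun_eq_iff restrict_def extensional_def)

lemma weighted_nodal_lagrange_weights:
  "weighted_nodal g {1..N} (lagrange_weights N g z) = nodal z {1..<N}"
  unfolding weighted_nodal_eq_nodal_iff[OF finite_atLeastAtMost card_N inj_g]
  by (simp add: lagrange_weights_def)

text \<open>Compare the coefficients of degree \<open>N - 1\<close> in the interpolation
  identity.\<close>

lemma sum_lagrange_weights: "(\<Sum>i\<in>{1..N}. lagrange_weights N g z i) = 1"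
  using coeff_weighted_nodal[OF finite_atLeastAtMost card_N, of g "lagrange_weights N g z"]
    coeff_nodal_card[of z "{1..<N}"]
  unfolding weighted_nodal_lagrange_weights by simp

text \<open>
  Pairing \<open>z j\<close> with \<open>g j\<close> for \<open>j < i\<close> and with \<open>g (j + 1)\<close> for \<open>j \<ge> i\<close> makes every factor of
  the quotient positive.
\<close>

lemma lagrange_weights_pos:
  assumes z: "z \<in> interlacing_box N g" and i: "i \<in> {1..N}"
  shows "0 < lagrange_weights N g z i"
proof -
  define p where "p j = (if j < i then j else j + 1)" for j
  have "bij_betw p {1..<N} ({1..N} - {i})"
    by (rule bij_betw_byWitness[where f' = "\<lambda>m. if m < i then m else m - 1"])
       (use i in \<open>auto simp: p_def split: if_splits\<close>)
  then have "(\<Prod>m\<in>{1..N} - {i}. g i - g m) = (\<Prod>j\<in>{1..<N}. g i - g (p j))"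
    by (rule prod.reindex_bij_betw[symmetric])
  then have "lagrange_weights N g z i = (\<Prod>j\<in>{1..<N}. (g i - z j) / (g i - g (p j)))"
    using i by (simp add: lagrange_weights_def prod_dividef)
  also have "\<dots> > 0"
  proof (rule prod_pos)
    fix j assume j: "j \<in> {1..<N}"
    have zj: "g j < z j" "z j < g (j + 1)" using box_gap[OF z j] by auto
    show "0 < (g i - z j) / (g i - g (p j))"
    proof (cases "j < i")
      case True
      then show ?thesis
        using node_above[OF j zj(2) i] zj by (simp add: p_def)
    next
      case False
      then show ?thesis
        using node_below[OF j zj(1) i] zj by (simp add: p_def divide_neg_neg)
    qed
  qed
  finally show ?thesis .
qed

lemma lagrange_weights_in_simplex:
  assumes z: "z \<in> interlacing_box N g"
  shows "lagrange_weights N g z \<in> open_simplex N"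
proof -
  have "lagrange_weights N g z i < 1" if i: "i \<in> {1..N}" for i
  proof -
    \<comment> \<open>A second index exists since \<open>N \<ge> 2\<close>; the positive weights at
      the other indices keep weight \<open>i\<close> below 1.\<close>
    have "(if i = 1 then 2 else 1) \<in> {1..N} - {i}" using N by auto
    then have "{1..N} - {i} \<noteq> {}" by blast
    then have "0 < (\<Sum>k\<in>{1..N} - {i}. lagrange_weights N g z k)"
      using lagrange_weights_pos[OF z] by (intro sum_pos) auto
    then show ?thesis
      using sum_lagrange_weights[of z] i by (simp add: sum.remove[of _ i])
  qed
  then show ?thesis
    using lagrange_weights_pos[OF z] sum_lagrange_weights
    by (auto simp: open_simplex_def PiE_iff) (simp add: lagrange_weights_def)
qed

text \<open>The numerator of \<open>m_fun\<close> for these weights is \<open>nodal z\<close>, which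
  vanishes at each \<open>z j\<close>, whereas the denominator does not.\<close>

lemma zero_map_lagrange_weights:
  assumes z: "z \<in> interlacing_box N g"
  shows "zero_map N g (lagrange_weights N g z) = z"
proof (rule zero_map_eqI[OF lagrange_weights_in_simplex[OF z] z])
  fix j assume j: "j \<in> {1..<N}"
  have zj: "z j \<notin> g ` {1..N}"
    using node_neq[OF j box_gap[OF z j]] by force
  have "(\<Prod>i\<in>{1..N}. g i - z j) \<noteq> 0"
    using node_neq[OF j box_gap[OF z j]] by (subst prod_zero_iff) auto
  moreover have "poly (nodal z {1..<N}) (z j) = 0"
    using j by (auto simp: poly_nodal)
  ultimately show "m_fun N g (lagrange_weights N g z) (z j) = 0"
    using poly_weighted_nodal[OF finite_atLeastAtMost zj, of "lagrange_weights N g z"]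
    unfolding weighted_nodal_lagrange_weights m_fun_def by simp
qed

lemma bij_betw_zero_map: "bij_betw (zero_map N g) (open_simplex N) (interlacing_box N g)"
  by (rule bij_betw_byWitness[where f' = "lagrange_weights N g"])
     (auto simp: lagrange_weights_zero_map zero_map_lagrange_weights zero_map_in_box
        lagrange_weights_in_simplex)

lemma inv_into_zero_map:
  assumes "z \<in> interlacing_box N g"
  shows "inv_into (open_simplex N) (zero_map N g) z = lagrange_weights N g z"
  using bij_betw_zero_map assms
  by (intro inv_into_f_eq) (auto simp: bij_betw_def zero_map_lagrange_weights lagrange_weights_in_simplex)

end

section \<open>Openness of the simplex and the box\<close>

lemma openin_open_simplex:
  "openin (subtopology (product_topology (\<lambda>_. euclideanreal) {1..N}) (sum_one_hyperplane N)) (open_simplex N)"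
  unfolding openin_subtopology
  by (rule exI[of _ "{1..N} \<rightarrow>\<^sub>E {0<..<1}"])
     (auto simp: openin_PiE_gen open_simplex_def sum_one_hyperplane_def PiE_iff extensional_def)

lemma openin_interlacing_box:
  "openin (subtopology (product_topology (\<lambda>_. euclideanreal) {1..<N}) ({1..<N} \<rightarrow>\<^sub>E UNIV)) (interlacing_box N g)"
  unfolding openin_subtopology
  by (rule exI[of _ "interlacing_box N g"])
     (auto simp: openin_PiE_gen interlacing_box_def PiE_iff)

section \<open>A contour integral for a simple zero\<close>

text \<open>
  The argument principle for \<open>q s = (\<Prod>l\<in>J. (z l - s) / (w l - s))\<close>, integrated by parts: only the
  index \<open>j\<close> contributes to the integral of \<open>s * q' s / q s\<close>, and \<open>s * ln (q s)\<close> is a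
  primitive of \<open>ln (q s) + s * q' s / q s\<close> near the circle.
\<close>

lemma contour_integral_ln_prod_quotient:
  fixes z w :: "'l \<Rightarrow> complex"
  assumes J: "finite J" "j \<in> J" and \<rho>: "0 < \<rho>" "\<rho> < R"
    and inside: "z j \<in> ball c \<rho>" "w j \<in> ball c \<rho>"
    and outside: "\<And>l. l \<in> J - {j} \<Longrightarrow> z l \<notin> ball c R" "\<And>l. l \<in> J - {j} \<Longrightarrow> w l \<notin> ball c R"
    and near_1: "\<And>s. s \<in> sphere c \<rho> \<Longrightarrow> norm ((\<Prod>l\<in>J. (z l - s) / (w l - s)) - 1) < 1"
  shows "((\<lambda>s. ln (\<Prod>l\<in>J. (z l - s) / (w l - s))) has_contour_integral
    2 * of_real pi * \<i> * (w j - z j)) (circlepath c \<rho>)"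
proof -
  define q where "q s = (\<Prod>l\<in>J. (z l - s) / (w l - s))" for s
  have ne: "s \<noteq> z l" "s \<noteq> w l" if "s \<in> sphere c \<rho>" "l \<in> J" for s l
    using that outside[of l] inside \<rho> by (cases "l = j"; force)+
  \<comment> \<open>Cauchy's formula handles \<open>p\<close> inside the circle. Outside the larger
    disc of radius \<open>R\<close>, the integrand is holomorphic on an open disc containing the
    circle and integrates to 0.\<close>
  have pole: "((\<lambda>s. s / (s - p)) has_contour_integral (if l = j then 2 * of_real pi * \<i> * p else 0))
      (circlepath c \<rho>)" if "if l = j then p \<in> ball c \<rho> else p \<notin> ball c R" for l p
  proof (cases "l = j")
    case True
    then show ?thesis
      using that Cauchy_integral_circlepath_simple[of "\<lambda>s. s" c \<rho> p]
      by (auto simp: dist_norm norm_minus_commute)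
  next
    case False
    have "((\<lambda>s. s / (s - p)) has_contour_integral 0) (circlepath c \<rho>)"
      using that False \<rho> by (intro Cauchy_theorem_disc_simple[of _ c R]) (auto intro!: holomorphic_intros)
    then show ?thesis using False by simp
  qed
  have "((\<lambda>s. \<Sum>l\<in>J. s / (s - z l) - s / (s - w l)) has_contour_integral
      (\<Sum>l\<in>J. (if l = j then 2 * of_real pi * \<i> * z l else 0) - (if l = j then 2 * of_real pi * \<i> * w l else 0)))
      (circlepath c \<rho>)"
    using inside outside
    by (intro has_contour_integral_sum has_contour_integral_diff pole J) auto
  moreover have "(\<Sum>l\<in>J. (if l = j then 2 * of_real pi * \<i> * z l else 0) - (if l = j then 2 * of_real pi * \<i> * w l else 0))
      = 2 * of_real pi * \<i> * (z j - w j)"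
    using J by (simp add: sum_subtractf algebra_simps)
  ultimately have log_deriv: "((\<lambda>s. \<Sum>l\<in>J. s / (s - z l) - s / (s - w l)) has_contour_integral
      2 * of_real pi * \<i> * (z j - w j)) (circlepath c \<rho>)"
    by simp
  have deriv: "((\<lambda>s. s * ln (q s)) has_field_derivative
      ln (q s) + (\<Sum>l\<in>J. s / (s - z l) - s / (s - w l))) (at s within sphere c \<rho>)"
    if s: "s \<in> sphere c \<rho>" for s
  proof -
    have q0: "q s \<noteq> 0"
      using ne[OF s] J by (auto simp: q_def)
    \<comment> \<open>A value within distance less than 1 of 1 has positive real part, so it avoids
      the branch cut of the logarithm.\<close>
    have "q s \<notin> \<real>\<^sub>\<le>\<^sub>0"
      using near_1[OF s] abs_Re_le_cmod[of "q s - 1"] unfolding q_def[symmetric]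
      by (auto simp: complex_nonpos_Reals_iff)
    moreover have "(q has_field_derivative (\<Sum>l\<in>J. (1 / (s - z l) - 1 / (s - w l))) * q s) (at s)"
    proof -
      have "((\<lambda>s. \<Prod>l\<in>J. (z l - s) / (w l - s)) has_field_derivative
          (\<Prod>l\<in>J. (z l - s) / (w l - s)) *
          (\<Sum>l\<in>J. ((z l - w l) / (w l - s)\<^sup>2) / ((z l - s) / (w l - s)))) (at s)"
      proof (rule has_field_derivative_prod')
        fix l assume l: "l \<in> J"
        show "(z l - s) / (w l - s) \<noteq> 0" using ne[OF s l] by auto
        show "((\<lambda>s. (z l - s) / (w l - s)) has_field_derivative (z l - w l) / (w l - s)\<^sup>2) (at s)"
          using ne[OF s l]
          by (auto intro!: derivative_eq_intros simp: power2_eq_square divide_simps)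
      qed
      moreover have "((z l - w l) / (w l - s)\<^sup>2) / ((z l - s) / (w l - s)) = 1 / (s - z l) - 1 / (s - w l)"
        if "l \<in> J" for l
        using ne[OF s that] by (simp add: divide_simps power2_eq_square) (simp add: algebra_simps)
      ultimately show ?thesis
        by (simp add: q_def[abs_def] mult.commute)
    qed
    ultimately have "((\<lambda>s. s * ln (q s)) has_field_derivative
        1 * ln (q s) + inverse (q s) * ((\<Sum>l\<in>J. (1 / (s - z l) - 1 / (s - w l))) * q s) * s) (at s)"
      by (intro DERIV_mult DERIV_ident has_field_derivative_Ln[THEN DERIV_chain2])
    moreover have "inverse (q s) * ((\<Sum>l\<in>J. (1 / (s - z l) - 1 / (s - w l))) * q s) * s
        = (\<Sum>l\<in>J. s / (s - z l) - s / (s - w l))"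
      using q0 by (simp add: sum_distrib_left sum_distrib_right algebra_simps)
    ultimately show ?thesis
      by (simp add: has_field_derivative_at_within)
  qed
  \<comment> \<open>The primitive is single-valued on the closed path, so the integral vanishes;
    subtracting \<open>log_deriv\<close> isolates the logarithm.\<close>
  have "((\<lambda>s. ln (q s) + (\<Sum>l\<in>J. s / (s - z l) - s / (s - w l))) has_contour_integral 0) (circlepath c \<rho>)"
    using contour_integral_primitive[OF deriv, of "circlepath c \<rho>"] \<rho> by simp
  from has_contour_integral_diff[OF this log_deriv] show ?thesis
    by (simp add: q_def algebra_simps)
qed

section \<open>Logarithm integrals expanded along words\<close>

lemma continuous_on_prod_list_map:
  fixes v :: "'i \<Rightarrow> 'b::topological_space \<Rightarrow> 'c::{topological_semigroup_mult, monoid_mult}"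
  assumes "\<And>i. i \<in> set xs \<Longrightarrow> continuous_on A (v i)"
  shows "continuous_on A (\<lambda>s. prod_list (map (\<lambda>i. v i s) xs))"
  using assms by (induction xs) (auto intro!: continuous_intros)

lemma divide_of_nat_le:
  fixes x :: real
  assumes "0 \<le> x"
  shows "x / real k \<le> x"
  using assms divide_left_mono[of 1 "real k" x] by (cases "k = 0") auto

text \<open>The logarithm series converges uniformly on the circle and may be integrated termwise.
  Expanding each power along words pulls the constants \<open>h i\<close> out of the integral and
  leaves coefficients that depend on \<open>v\<close> alone.\<close>

lemma contour_integral_ln_expansion:
  fixes v :: "'i \<Rightarrow> complex \<Rightarrow> complex"
  assumes I: "finite I" and \<rho>: "0 < \<rho>"
    and cont: "\<And>i. i \<in> I \<Longrightarrow> continuous_on (sphere c \<rho>) (v i)"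
    and bound: "\<And>i s. i \<in> I \<Longrightarrow> s \<in> sphere c \<rho> \<Longrightarrow> norm (v i s) \<le> D"
    and small: "(\<Sum>i\<in>I. norm (h i)) * D < 1" and D: "0 \<le> D"
  shows "(\<lambda>k. \<Sum>xs\<in>words I k. - ((-1) ^ k) / of_nat k *
      contour_integral (circlepath c \<rho>) (\<lambda>s. prod_list (map (\<lambda>i. v i s) xs)) * prod_list (map h xs))
    sums contour_integral (circlepath c \<rho>) (\<lambda>s. ln (1 + (\<Sum>i\<in>I. h i * v i s)))"
proof -
  define u where "u s = (\<Sum>i\<in>I. h i * v i s)" for s
  define \<theta> where "\<theta> = (\<Sum>i\<in>I. norm (h i)) * D"
  have \<theta>: "0 \<le> \<theta>" "\<theta> < 1"
    using small D by (auto simp: \<theta>_def intro!: mult_nonneg_nonneg sum_nonneg)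
  have u: "norm (u s) \<le> \<theta>" if "s \<in> sphere c \<rho>" for s
  proof -
    have "norm (u s) \<le> (\<Sum>i\<in>I. norm (h i) * D)"
      unfolding u_def by (rule sum_norm_le) (auto simp: norm_mult intro!: mult_left_mono bound that)
    then show ?thesis by (simp add: \<theta>_def sum_distrib_right)
  qed
  \<comment> \<open>Division by zero is 0, so the term for \<open>k = 0\<close> vanishes and the
    series can start there.\<close>
  define t where "t k s = - ((- u s) ^ k) / of_nat k" for k s
  have int_word: "(\<lambda>s. prod_list (map (\<lambda>i. v i s) xs)) contour_integrable_on circlepath c \<rho>"
    if "xs \<in> words I k" for xs k
    using that \<rho>
    by (intro contour_integrable_continuous_circlepath)
       (auto simp: words_def intro!: continuous_on_prod_list_map cont)
  have t_words: "t k s = (\<Sum>xs\<in>words I k. - ((-1) ^ k) / of_nat k * prod_list (map h xs) *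
      prod_list (map (\<lambda>i. v i s) xs))" for k s
  proof -
    have "prod_list (map (\<lambda>i. h i * v i s) xs) = prod_list (map h xs) * prod_list (map (\<lambda>i. v i s) xs)" for xs
      by (induction xs) auto
    then have "u s ^ k = (\<Sum>xs\<in>words I k. prod_list (map h xs) * prod_list (map (\<lambda>i. v i s) xs))"
      unfolding u_def by (simp flip: sum_words_prod_list)
    moreover have "t k s = - ((-1) ^ k) / of_nat k * u s ^ k"
      unfolding t_def by (subst power_minus) simp
    ultimately show ?thesis
      by (simp add: sum_distrib_left mult.assoc)
  qed
  have int_t: "t k contour_integrable_on circlepath c \<rho>" for k
    unfolding t_words
    by (intro contour_integrable_sum contour_integrable_lmul int_word finite_words I)
  have integral_t: "contour_integral (circlepath c \<rho>) (t k) = (\<Sum>xs\<in>words I k. - ((-1) ^ k) / of_nat k *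
      contour_integral (circlepath c \<rho>) (\<lambda>s. prod_list (map (\<lambda>i. v i s) xs)) * prod_list (map h xs))" for k
  proof -
    have "contour_integral (circlepath c \<rho>) (\<lambda>s. \<Sum>xs\<in>words I k. A xs * prod_list (map (\<lambda>i. v i s) xs))
        = (\<Sum>xs\<in>words I k. A xs * contour_integral (circlepath c \<rho>) (\<lambda>s. prod_list (map (\<lambda>i. v i s) xs)))" for A
      by (simp add: contour_integral_sum contour_integral_lmul contour_integrable_lmul int_word
            finite_words I)
    from this[of "\<lambda>xs. - ((-1) ^ k) / of_nat k * prod_list (map h xs)"] show ?thesis
      unfolding t_words by (simp only: mult_ac)
  qed
  have ln_eq: "(\<Sum>k. t k s) = ln (1 + u s)" if "s \<in> sphere c \<rho>" for s
    using Ln_series'[of "u s"] u[OF that] \<theta> by (simp add: t_def sums_iff)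
  have "uniform_limit (sphere c \<rho>) (\<lambda>n s. \<Sum>k<n. t k s) (\<lambda>s. \<Sum>k. t k s) sequentially"
  proof (rule Weierstrass_m_test)
    fix k s assume s: "s \<in> sphere c \<rho>"
    have "norm (t k s) = norm (u s) ^ k / real k"
      by (simp add: t_def norm_divide norm_power)
    also have "\<dots> \<le> norm (u s) ^ k"
      by (rule divide_of_nat_le) simp
    also have "\<dots> \<le> \<theta> ^ k" using u[OF s] by (rule power_mono) simp
    finally show "norm (t k s) \<le> \<theta> ^ k" .
  qed (use \<theta> in \<open>auto intro: summable_geometric\<close>)
  then have "uniform_limit (sphere c \<rho>) (\<lambda>n s. \<Sum>k<n. t k s) (\<lambda>s. ln (1 + u s)) sequentially"
    by (rule uniform_limit_cong'[THEN iffD1, rotated -1]) (use ln_eq in auto)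
  then have "(\<lambda>n. contour_integral (circlepath c \<rho>) (\<lambda>s. \<Sum>k<n. t k s))
      \<longlonglongrightarrow> contour_integral (circlepath c \<rho>) (\<lambda>s. ln (1 + u s))"
    using \<rho> by (intro contour_integral_uniform_limit_circlepath(2))
      (auto intro!: always_eventually contour_integrable_sum int_t)
  then have "(\<lambda>k. contour_integral (circlepath c \<rho>) (t k)) sums
      contour_integral (circlepath c \<rho>) (\<lambda>s. ln (1 + u s))"
    by (simp add: sums_def contour_integral_sum int_t)
  then show ?thesis
    by (simp only: integral_t u_def)
qed

text \<open>Circle length times maximum of the integrand; this supplies the geometric coefficient
  bound of \<open>real_analytic_onI_words\<close>.\<close>

lemma norm_contour_integral_prod_list_le:
  assumes "0 < \<rho>" "set xs \<subseteq> I" "0 \<le> D"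
    and cont: "\<And>i. i \<in> I \<Longrightarrow> continuous_on (sphere c \<rho>) (v i)"
    and bound: "\<And>i s. i \<in> I \<Longrightarrow> s \<in> sphere c \<rho> \<Longrightarrow> norm (v i s :: complex) \<le> D"
  shows "norm (contour_integral (circlepath c \<rho>) (\<lambda>s. prod_list (map (\<lambda>i. v i s) xs)))
    \<le> D ^ length xs * (2 * pi * \<rho>)"
proof (rule has_contour_integral_bound_circlepath)
  show "((\<lambda>s. prod_list (map (\<lambda>i. v i s) xs)) has_contour_integral
      contour_integral (circlepath c \<rho>) (\<lambda>s. prod_list (map (\<lambda>i. v i s) xs))) (circlepath c \<rho>)"
    using assms(1,2)
    by (intro has_contour_integral_integral contour_integrable_continuous_circlepath)
       (auto intro!: continuous_on_prod_list_map cont)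
  fix s assume "norm (s - c) = \<rho>"
  then have s: "s \<in> sphere c \<rho>" by (simp add: dist_norm norm_minus_commute)
  show "norm (prod_list (map (\<lambda>i. v i s) xs)) \<le> D ^ length xs"
    using assms(2)
  proof (induction xs)
    case (Cons i xs)
    then show ?case
      using bound[OF _ s, of i] assms(3) by (auto simp: norm_mult intro!: mult_mono)
  qed simp
qed (use assms in auto)

section \<open>Analyticity of the zero map\<close>

context interlacing
begin

text \<open>The weight formula is an identity of real numbers and survives \<open>of_real\<close>;
  interpolation at the embedded nodes then forces the complex polynomials to coincide.\<close>

lemma m_fun_factorization_complex:
  assumes y: "y \<in> open_simplex N" and s: "\<And>i. i \<in> {1..N} \<Longrightarrow> of_real (g i) \<noteq> (s :: complex)"
  shows "(\<Sum>i\<in>{1..N}. of_real (y i) / (of_real (g i) - s)) * (\<Prod>i\<in>{1..N}. of_real (g i) - s)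
    = (\<Prod>j\<in>{1..<N}. of_real (zero_map N g y j) - s)"
proof -
  let ?g = "\<lambda>i. complex_of_real (g i)" and ?y = "\<lambda>i. complex_of_real (y i)"
    and ?z = "\<lambda>j. complex_of_real (zero_map N g y j)"
  have "inj_on ?g {1..N}"
    by (rule inj_onI) (simp add: inj_onD[OF inj_g])
  moreover have "\<forall>i\<in>{1..N}. ?y i = (\<Prod>j\<in>{1..<N}. ?g i - ?z j) / (\<Prod>m\<in>{1..N} - {i}. ?g i - ?g m)"
    using weighted_nodal_zero_map[OF y]
    unfolding weighted_nodal_eq_nodal_iff[OF finite_atLeastAtMost card_N inj_g]
    by (simp flip: of_real_diff of_real_prod of_real_divide)
  ultimately have "weighted_nodal ?g {1..N} ?y = nodal ?z {1..<N}"
    using weighted_nodal_eq_nodal_iff[OF finite_atLeastAtMost card_N, of ?g ?y ?z] by blast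
  moreover have "s \<notin> ?g ` {1..N}" using s by blast
  ultimately show ?thesis
    using poly_weighted_nodal[of "{1..N}" s ?g ?y] by (simp add: poly_nodal)
qed

lemma real_analytic_on_zero_map:
  assumes j: "j \<in> {1..<N}"
  shows "real_analytic_on {1..N} (open_simplex N) (\<lambda>y. zero_map N g y j)"
proof (rule real_analytic_onI_words)
  fix a assume a: "a \<in> open_simplex N"
  define w where "w = zero_map N g a"
  define c where "c = complex_of_real (w j)"
  have w: "w \<in> interlacing_box N g"
    unfolding w_def by (rule zero_map_in_box[OF a])
  \<comment> \<open>The distance from \<open>w j\<close> to the nearer end of its gap: the open disc
    of radius \<open>R\<close> contains no node and, for any point of the box, no coordinate other
    than the \<open>j\<close>-th.\<close>
  define R where "R = min (w j - g j) (g (j + 1) - w j)"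
  have R: "0 < R" "w j - R \<ge> g j" "w j + R \<le> g (j + 1)"
    using box_gap[OF w j] by (auto simp: R_def)
  define \<rho> where "\<rho> = R / 2"
  have \<rho>: "0 < \<rho>" "\<rho> < R" using R by (auto simp: \<rho>_def)
  have in_ball: "complex_of_real t \<in> ball c e \<longleftrightarrow> \<bar>t - w j\<bar> < e" for t e
    by (simp add: c_def dist_norm abs_minus_commute flip: of_real_diff)
  have outside: "complex_of_real (g i) \<notin> ball c R" if "i \<in> {1..N}" for i
  proof -
    have "g i \<notin> {g j<..<g (j + 1)}" using node_neq[OF j _ that] by blast
    then show ?thesis unfolding in_ball using R by auto
  qed
  have outside_zero: "complex_of_real (z l) \<notin> ball c R"
    if "z \<in> interlacing_box N g" "l \<in> {1..<N} - {j}" for z l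
  proof -
    have "z l \<notin> {g j<..<g (j + 1)}"
      using disjoint_gaps[OF j _ _ box_gap[OF that(1)], of l] that(2) by blast
    then show ?thesis unfolding in_ball using R by auto
  qed
  have sphere_sub: "s \<in> ball c R" if "s \<in> sphere c \<rho>" for s
    using that \<rho> by simp
  define m where "m y s = (\<Sum>i\<in>{1..N}. complex_of_real (y i) / (of_real (g i) - s))" for y s
  have gs: "complex_of_real (g i) \<noteq> s" if "s \<in> sphere c \<rho>" "i \<in> {1..N}" for s i
    using outside[OF that(2)] sphere_sub[OF that(1)] by auto
  have factor: "m y s * (\<Prod>i\<in>{1..N}. of_real (g i) - s)
      = (\<Prod>l\<in>{1..<N}. of_real (zero_map N g y l) - s)"
    if "y \<in> open_simplex N" "s \<in> sphere c \<rho>" for y s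
    unfolding m_def by (rule m_fun_factorization_complex[OF that(1) gs[OF that(2)]])
  have m_a: "m a s \<noteq> 0" if s: "s \<in> sphere c \<rho>" for s
  proof -
    have "of_real (w l) \<noteq> s" if "l \<in> {1..<N}" for l
      using outside_zero[OF w, of l] that sphere_sub[OF s] s \<rho>
      by (cases "l = j") (auto simp: c_def)
    then have "(\<Prod>l\<in>{1..<N}. of_real (w l) - s) \<noteq> 0" by auto
    then show ?thesis using factor[OF a s] by (auto simp: w_def)
  qed
  \<comment> \<open>The coefficient of \<open>y i - a i\<close> in
    \<open>(m y s - m a s) / m a s\<close>.\<close>
  define v where "v i s = 1 / ((complex_of_real (g i) - s) * m a s)" for i s
  have cont_v: "continuous_on (sphere c \<rho>) (v i)" if "i \<in> {1..N}" for i
    unfolding v_def m_def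
    by (intro continuous_intros) (use gs that m_a m_def in auto)
  have "\<exists>D>0. \<forall>i\<in>{1..N}. \<forall>s\<in>sphere c \<rho>. norm (v i s) \<le> D"
  proof -
    have "\<exists>D. \<forall>s\<in>sphere c \<rho>. norm (v i s) \<le> D" if "i \<in> {1..N}" for i
      using compact_imp_bounded[OF compact_continuous_image[OF cont_v[OF that]]]
      by (auto simp: bounded_iff)
    then obtain D where D: "\<And>i s. i \<in> {1..N} \<Longrightarrow> s \<in> sphere c \<rho> \<Longrightarrow> norm (v i s) \<le> D i"
      by metis
    have "norm (v i s) \<le> 1 + (\<Sum>i\<in>{1..N}. \<bar>D i\<bar>)" if "i \<in> {1..N}" "s \<in> sphere c \<rho>" for i s
    proof -
      have "norm (v i s) \<le> \<bar>D i\<bar>" using D[OF that] by linarith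
      also have "\<dots> \<le> (\<Sum>i\<in>{1..N}. \<bar>D i\<bar>)" using that by (intro member_le_sum) auto
      finally show ?thesis by linarith
    qed
    then show ?thesis
      by (intro exI[of _ "1 + (\<Sum>i\<in>{1..N}. \<bar>D i\<bar>)"]) (auto simp: sum_nonneg add_pos_nonneg)
  qed
  then obtain D where D: "D > 0" "\<And>i s. i \<in> {1..N} \<Longrightarrow> s \<in> sphere c \<rho> \<Longrightarrow> norm (v i s) \<le> D"
    by blast
  \<comment> \<open>Chosen so that \<open>real N * r * D\<close> equals 1/2.\<close>
  define r where "r = 1 / (2 * real N * D)"
  have r: "r > 0" "real N * r * D < 1"
    using N D by (auto simp: r_def)
  define E where "E xs = - ((-1) ^ length xs) / of_nat (length xs) *
      contour_integral (circlepath c \<rho>) (\<lambda>s. prod_list (map (\<lambda>i. v i s) xs))" for xs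
  \<comment> \<open>Division by zero makes \<open>E []\<close> vanish, so the constant term
    \<open>w j\<close> is put at the empty word. Taking the real part keeps the coefficients
    real.\<close>
  define C where "C xs = (if xs = [] then w j else 0) - Re (E xs / (2 * of_real pi * \<i>))" for xs
  have C_bound: "\<bar>C xs\<bar> \<le> (\<bar>w j\<bar> + \<rho>) * D ^ length xs" if xs: "set xs \<subseteq> {1..N}" for xs
  proof -
    have "norm (E xs) \<le> norm (contour_integral (circlepath c \<rho>) (\<lambda>s. prod_list (map (\<lambda>i. v i s) xs)))"
      unfolding E_def norm_mult norm_divide
      by (simp add: norm_power divide_of_nat_le[of _ "length xs"])
    also have "\<dots> \<le> D ^ length xs * (2 * pi * \<rho>)"
      using xs D(1) by (intro norm_contour_integral_prod_list_le[OF \<rho>(1), of _ "{1..N}"] cont_v D(2)) auto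
    finally have "norm (E xs / (2 * of_real pi * \<i>)) \<le> D ^ length xs * \<rho>"
      by (simp add: norm_divide norm_mult field_simps)
    then have "\<bar>Re (E xs / (2 * of_real pi * \<i>))\<bar> \<le> D ^ length xs * \<rho>"
      using abs_Re_le_cmod order_trans by blast
    moreover have "\<bar>if xs = [] then w j else 0\<bar> \<le> \<bar>w j\<bar> * D ^ length xs"
      using D(1) by simp
    ultimately show ?thesis
      unfolding C_def by (simp add: algebra_simps)
  qed
  have expansion: "(\<lambda>k. \<Sum>xs\<in>words {1..N} k. C xs * prod_list (map (\<lambda>i. x i - a i) xs)) sums zero_map N g x j"
    if x: "x \<in> open_simplex N" and near: "\<And>i. i \<in> {1..N} \<Longrightarrow> \<bar>x i - a i\<bar> < r" for x
  proof -
    define z where "z = zero_map N g x"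
    have z: "z \<in> interlacing_box N g"
      unfolding z_def by (rule zero_map_in_box[OF x])
    define u where "u s = (\<Sum>i\<in>{1..N}. complex_of_real (x i - a i) * v i s)" for s
    have sum_near: "(\<Sum>i\<in>{1..N}. \<bar>x i - a i\<bar>) \<le> real N * r"
      using sum_bounded_above[of "{1..N}" "\<lambda>i. \<bar>x i - a i\<bar>" r] near by (simp add: less_imp_le)
    have small: "(\<Sum>i\<in>{1..N}. norm (complex_of_real (x i - a i))) * D < 1"
      using mult_right_mono[OF sum_near less_imp_le[OF D(1)]] r(2) unfolding norm_of_real by linarith
    have u_less: "norm (u s) < 1" if s: "s \<in> sphere c \<rho>" for s
    proof -
      have "norm (u s) \<le> (\<Sum>i\<in>{1..N}. norm (complex_of_real (x i - a i)) * D)"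
        unfolding u_def by (rule sum_norm_le) (simp only: norm_mult mult_left_mono D(2) s norm_ge_zero)
      then show ?thesis using small by (simp only: sum_distrib_right)
    qed
    have u_quot: "1 + u s = m x s / m a s" if s: "s \<in> sphere c \<rho>" for s
    proof -
      have "u s = (\<Sum>i\<in>{1..N}. of_real (x i - a i) / (of_real (g i) - s)) / m a s"
        by (simp add: u_def v_def sum_divide_distrib)
      also have "(\<Sum>i\<in>{1..N}. of_real (x i - a i) / (of_real (g i) - s)) = m x s - m a s"
        by (simp add: m_def diff_divide_distrib sum_subtractf)
      finally show ?thesis using m_a[OF s] by (simp add: field_simps)
    qed
    have u_prod: "1 + u s = (\<Prod>l\<in>{1..<N}. (of_real (z l) - s) / (of_real (w l) - s))"
      if s: "s \<in> sphere c \<rho>" for s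
    proof -
      have "(\<Prod>i\<in>{1..N}. complex_of_real (g i) - s) \<noteq> 0"
        using gs[OF s] by auto
      then show ?thesis
        unfolding u_quot[OF s] prod_dividef z_def w_def factor[OF a s, symmetric] factor[OF x s, symmetric]
        by simp
    qed
    \<comment> \<open>On the circle \<open>1 + u\<close> has positive real part, so the functions
      for \<open>x\<close> and \<open>a\<close> have equal signs at \<open>w j - \<rho>\<close> and
      \<open>w j + \<rho>\<close>. Monotonicity then traps the zero for \<open>x\<close> between
      these points.\<close>
    have inside: "\<bar>z j - w j\<bar> < \<rho>"
    proof -
      have m_real: "m y (of_real t) = of_real (m_fun N g y t)" for y t
        by (simp add: m_def m_fun_def)
      have same_sign: "m_fun N g x t / m_fun N g a t > 0" if "\<bar>t - w j\<bar> = \<rho>" for t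
      proof -
        have t: "complex_of_real t \<in> sphere c \<rho>"
          using that by (simp add: c_def dist_norm abs_minus_commute flip: of_real_diff)
        have "0 < Re (1 + u (of_real t))"
          using u_less[OF t] abs_Re_le_cmod[of "u (of_real t)"] by auto
        then show ?thesis
          unfolding u_quot[OF t] m_real by (simp flip: of_real_divide)
      qed
      have gap: "w j - \<rho> \<in> {g j<..<g (j + 1)}" "w j + \<rho> \<in> {g j<..<g (j + 1)}"
        using R \<rho> by auto
      have "m_fun N g a (w j - \<rho>) < 0"
        using m_fun_less[OF a j gap(1) box_gap[OF w j]] m_fun_zero_map[OF a j] \<rho>
        by (simp add: w_def)
      moreover have "0 < m_fun N g a (w j + \<rho>)"
        using m_fun_less[OF a j box_gap[OF w j] gap(2)] m_fun_zero_map[OF a j] \<rho>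
        by (simp add: w_def)
      ultimately have "m_fun N g x (w j - \<rho>) < 0" "0 < m_fun N g x (w j + \<rho>)"
        using same_sign[of "w j - \<rho>"] same_sign[of "w j + \<rho>"] \<rho>
        by (auto simp: zero_less_divide_iff)
      moreover have "m_fun N g x (z j) = 0"
        unfolding z_def by (rule m_fun_zero_map[OF x j])
      ultimately have "z j \<noteq> w j - \<rho>" "z j \<noteq> w j + \<rho>"
          "\<not> z j < w j - \<rho>" "\<not> w j + \<rho> < z j"
        using m_fun_less[OF x j box_gap[OF z j] gap(1)]
          m_fun_less[OF x j gap(2) box_gap[OF z j]] by auto
      then show ?thesis by linarith
    qed
    have "((\<lambda>s. ln (\<Prod>l\<in>{1..<N}. (of_real (z l) - s) / (of_real (w l) - s))) has_contour_integral
        2 * of_real pi * \<i> * (of_real (w j) - of_real (z j))) (circlepath c \<rho>)"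
    proof (rule contour_integral_ln_prod_quotient[OF _ j \<rho>])
      show "complex_of_real (z j) \<in> ball c \<rho>" "complex_of_real (w j) \<in> ball c \<rho>"
        using inside \<rho> unfolding in_ball by auto
      fix s assume "s \<in> sphere c \<rho>"
      then show "norm ((\<Prod>l\<in>{1..<N}. (complex_of_real (z l) - s) / (of_real (w l) - s)) - 1) < 1"
        using u_less u_prod[symmetric] by simp
    qed (use outside_zero z w in auto)
    then have "((\<lambda>s. ln (1 + u s)) has_contour_integral
        2 * of_real pi * \<i> * (of_real (w j) - of_real (z j))) (circlepath c \<rho>)"
      by (rule has_contour_integral_eq) (use u_prod \<rho> in auto)
    then have "contour_integral (circlepath c \<rho>) (\<lambda>s. ln (1 + u s))
        = 2 * of_real pi * \<i> * of_real (w j - z j)"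
      by (simp add: contour_integral_unique)
    moreover have "(\<lambda>k. \<Sum>xs\<in>words {1..N} k. - ((-1) ^ k) / of_nat k *
        contour_integral (circlepath c \<rho>) (\<lambda>s. prod_list (map (\<lambda>i. v i s) xs)) *
        prod_list (map (\<lambda>i. complex_of_real (x i - a i)) xs))
        sums contour_integral (circlepath c \<rho>) (\<lambda>s. ln (1 + u s))"
      unfolding u_def
      by (rule contour_integral_ln_expansion[OF _ \<rho>(1) cont_v D(2) small]) (use D(1) in auto)
    moreover have "(\<Sum>xs\<in>words {1..N} k. - ((-1) ^ k) / of_nat k *
        contour_integral (circlepath c \<rho>) (\<lambda>s. prod_list (map (\<lambda>i. v i s) xs)) *
        prod_list (map (\<lambda>i. complex_of_real (x i - a i)) xs))
        = (\<Sum>xs\<in>words {1..N} k. E xs * of_real (prod_list (map (\<lambda>i. x i - a i) xs)))" for k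
    proof (rule sum.cong[OF refl])
      fix xs assume "xs \<in> words {1..N} k"
      moreover have "prod_list (map (\<lambda>i. complex_of_real (x i - a i)) xs)
          = of_real (prod_list (map (\<lambda>i. x i - a i) xs))"
        by (induction xs) auto
      ultimately show "- ((-1) ^ k) / of_nat k *
        contour_integral (circlepath c \<rho>) (\<lambda>s. prod_list (map (\<lambda>i. v i s) xs)) *
        prod_list (map (\<lambda>i. complex_of_real (x i - a i)) xs)
        = E xs * of_real (prod_list (map (\<lambda>i. x i - a i) xs))"
        by (simp only: E_def words_def mem_Collect_eq)
    qed
    ultimately have "(\<lambda>k. \<Sum>xs\<in>words {1..N} k. E xs * of_real (prod_list (map (\<lambda>i. x i - a i) xs)))
        sums (2 * of_real pi * \<i> * of_real (w j - z j))"
      by simp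
    \<comment> \<open>The monomials in \<open>x i - a i\<close> are real, so the real part passes to
      the coefficients.\<close>
    from sums_Re[OF sums_divide[OF this, of "2 * of_real pi * \<i>"]]
    have "(\<lambda>k. \<Sum>xs\<in>words {1..N} k. Re (E xs / (2 * of_real pi * \<i>)) * prod_list (map (\<lambda>i. x i - a i) xs))
        sums (w j - z j)"
      by (simp add: sum_divide_distrib times_divide_eq_left[symmetric] del: times_divide_eq_left)
    moreover have "(\<lambda>k. \<Sum>xs\<in>words {1..N} k. (if xs = [] then w j else 0) * prod_list (map (\<lambda>i. x i - a i) xs))
        sums w j"
    proof -
      have "(\<Sum>xs\<in>words {1..N} k. (if xs = [] then w j else 0) * prod_list (map (\<lambda>i. x i - a i) xs))
          = (if k = 0 then w j else 0)" for k
        by (cases "k = 0") (simp add: words_0, auto simp: words_def intro!: sum.neutral)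
      then show ?thesis using sums_single[of 0 "\<lambda>_. w j"] by simp
    qed
    ultimately have "(\<lambda>k. (\<Sum>xs\<in>words {1..N} k. (if xs = [] then w j else 0) * prod_list (map (\<lambda>i. x i - a i) xs))
        - (\<Sum>xs\<in>words {1..N} k. Re (E xs / (2 * of_real pi * \<i>)) * prod_list (map (\<lambda>i. x i - a i) xs)))
        sums (w j - (w j - z j))"
      by (intro sums_diff)
    then show ?thesis
      unfolding C_def left_diff_distrib sum_subtractf by (simp add: z_def)
  qed
  show "\<exists>r>0. \<exists>C B D. 0 \<le> D \<and> real (card {1..N}) * r * D < 1 \<and>
      (\<forall>xs. set xs \<subseteq> {1..N} \<longrightarrow> \<bar>C xs\<bar> \<le> B * D ^ length xs) \<and>
      (\<forall>x\<in>open_simplex N. (\<forall>i\<in>{1..N}. \<bar>x i - a i\<bar> < r) \<longrightarrow>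
        (\<lambda>k. \<Sum>xs\<in>words {1..N} k. C xs * prod_list (map (\<lambda>i. x i - a i) xs)) sums zero_map N g x j)"
    using r D(1) C_bound expansion
    by (intro exI[of _ r] exI[of _ C] exI[of _ "\<bar>w j\<bar> + \<rho>"] exI[of _ D] conjI) auto
qed simp

text \<open>Analyticity on the box depends only on values there, where \<open>inv_into\<close> is a
  constant times a product of affine factors.\<close>

lemma real_analytic_on_inv_zero_map:
  assumes i: "i \<in> {1..N}"
  shows "real_analytic_on {1..<N} (interlacing_box N g)
    (\<lambda>z. inv_into (open_simplex N) (zero_map N g) z i)"
proof -
  let ?K = "1 / (\<Prod>m\<in>{1..N} - {i}. g i - g m)"
  have "real_analytic_on {1..<N} (interlacing_box N g) (\<lambda>z. ?K * (\<Prod>j\<in>{1..<N}. g i - z j))"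
    by (rule real_analytic_on_prod_diff) simp
  moreover have "inv_into (open_simplex N) (zero_map N g) z i = ?K * (\<Prod>j\<in>{1..<N}. g i - z j)"
    if "z \<in> interlacing_box N g" for z
    using i by (simp add: inv_into_zero_map[OF that] lagrange_weights_def)
  ultimately show ?thesis
    by (simp add: real_analytic_on_def)
qed

end

theorem theorem4p4:
  fixes N :: nat and g :: "nat \<Rightarrow> real"
  assumes "N \<ge> 2"
    and "0 < g 1"
    and "strict_mono_on {1..N} g"
  shows "(\<forall>y\<in>open_simplex N. \<forall>j\<in>{1..<N}.
            \<exists>!z. z \<in> {g j<..<g (j + 1)} \<and> m_fun N g y z = 0)
       \<and> real_analytic_diffeomorphism
            {1..N} (sum_one_hyperplane N) (open_simplex N)
            {1..<N} ({1..<N} \<rightarrow>\<^sub>E UNIV) (interlacing_box N g)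
            (zero_map N g)
       \<and> (\<forall>z\<in>interlacing_box N g. \<forall>i\<in>{1..N}.
            inv_into (open_simplex N) (zero_map N g) z i
              = (\<Prod>j\<in>{1..<N}. g i - z j) / (\<Prod>m\<in>{1..N} - {i}. g i - g m))"
proof -
  interpret interlacing N g
    by unfold_locales fact+
  show ?thesis
    unfolding real_analytic_diffeomorphism_def
    by (intro conjI ballI m_fun_ex1_zero openin_open_simplex openin_interlacing_box bij_betw_zero_map
          real_analytic_on_zero_map real_analytic_on_inv_zero_map)
       (simp_all add: inv_into_zero_map lagrange_weights_def)
qed

end
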